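(* Let $n\ge2$, let $\mathcal{W}$ be a Hilbert space, let $(M_{\Phi_1},\ldots,M_{\Phi_n})$ be a model $n$-isometry on $H^2_{\mathcal{W}}(\mathbb{D})$, and let $\mathcal{S}$ be a closed subspace of $H^2_{\mathcal{W}}(\mathbb{D})$. Suppose there are a Hilbert space $\mathcal{W}_*$, an inner function $\Theta\in H^\infty_{\mathcal{B}(\mathcal{W}_*,\mathcal{W})}(\mathbb{D})$ and a model $n$-isometry $(M_{\Psi_1},\ldots,M_{\Psi_n})$ on $H^2_{\mathcal{W}_*}(\mathbb{D})$ such that $\mathcal{S}=\Theta H^2_{\mathcal{W}_*}(\mathbb{D})$ and $\Phi_i\Theta=\Theta\Psi_i$ for all $i=1,\ldots,n$. If $\hat{\mathcal{W}}$ is a Hilbert space, $\hat\Theta\in H^\infty_{\mathcal{B}(\hat{\mathcal{W}},\mathcal{W})}(\mathbb{D})$ is an inner function and $(M_{\hat\Psi_1},\ldots,M_{\hat\Psi_n})$ is a model $n$-isometry on $H^2_{\hat{\mathcal{W}}}(\mathbb{D})$ such that $\mathcal{S}=\hat\Theta H^2_{\hat{\mathcal{W}}}(\mathbb{D})$ and $\Phi_i\hat\Theta=\hat\Theta\hat\Psi_i$ for all $i=1,\ldots,n$, then there exists a unitary $\tau:\mathcal{W}_*\to\hat{\mathcal{W}}$ such that \[ \Theta=\hat\Theta\tau \] and \[ \hat\Psi_j\tau=\tau\Psi_j \] for all $j=1,\ldots,n$.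
   Context: For Hilbert spaces $\mathcal{E},\mathcal{F}$, $H^2_{\mathcal{E}}(\mathbb{D})$ is the $\mathcal{E}$-valued Hardy space on the unit disc, $H^\infty_{\mathcal{B}(\mathcal{E},\mathcal{F})}(\mathbb{D})$ is the space of bounded $\mathcal{B}(\mathcal{E},\mathcal{F})$-valued holomorphic functions on $\mathbb{D}$, and $M_\Theta:H^2_{\mathcal{E}}(\mathbb{D})\to H^2_{\mathcal{F}}(\mathbb{D})$ is multiplication by $\Theta$; $\Theta$ is inner if $M_\Theta$ is an isometry (equivalently, its boundary values are isometries a.e. on the unit circle). A unitary $\tau$ between coefficient spaces is regarded as a constant function. Model $n$-isometry: let $\mathcal{E}$ be a Hilbert space, $U_1,\ldots,U_n$ unitary operators on $\mathcal{E}$ and $P_1,\ldots,P_n$ orthogonal projections on $\mathcal{E}$ (with $P_i^\perp=I_{\mathcal{E}}-P_i$), and put $\Phi_i(z)=U_i(P_i^\perp+zP_i)$, $z\in\mathbb{D}$. The tuple $(M_{\Phi_1},\ldots,M_{\Phi_n})$ on $H^2_{\mathcal{E}}(\mathbb{D})$ is a model $n$-isometry if: (a) $U_iU_j=U_jU_i$ for all $i,j$; (b) $U_1\cdots U_n=I_{\mathcal{E}}$; (c) $P_i+U_i^*P_jU_i=P_j+U_j^*P_iU_j\le I_{\mathcal{E}}$ for all $i\ne j$; (d) $P_1+U_1^*P_2U_1+U_1^*U_2^*P_3U_2U_1+\cdots+U_1^*U_2^*\cdots U_{n-1}^*P_nU_{n-1}\cdots U_2U_1=I_{\mathcal{E}}$.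 *)

theory Defs
  imports "HOL-Analysis.Analysis"
begin

class complex_normed_vector = real_normed_vector +
  fixes scaleC :: "complex \<Rightarrow> 'a \<Rightarrow> 'a"  (infixr "*\<^sub>C" 75)
  assumes scaleC_add_right: "c *\<^sub>C (x + y) = c *\<^sub>C x + c *\<^sub>C y"
    and scaleC_add_left: "(c + d) *\<^sub>C x = c *\<^sub>C x + d *\<^sub>C x"
    and scaleC_scaleC: "c *\<^sub>C d *\<^sub>C x = (c * d) *\<^sub>C x"
    and scaleC_of_real: "complex_of_real r *\<^sub>C x = r *\<^sub>R x"
    and norm_scaleC: "norm (c *\<^sub>C x) = cmod c * norm x"

text \<open>Positivity and definiteness of the inner product follow from \<open>cinner_self\<close>
  and the norm axioms. The inner product is linear in the first argument.\<close>

class complex_hilbert = complex_normed_vector + banach +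
  fixes cinner :: "'a \<Rightarrow> 'a \<Rightarrow> complex"
  assumes cinner_add_left: "cinner (x + y) z = cinner x z + cinner y z"
    and cinner_scaleC_left: "cinner (c *\<^sub>C x) y = c * cinner x y"
    and cinner_commute: "cinner y x = cnj (cinner x y)"
    and cinner_self: "cinner x x = complex_of_real ((norm x)\<^sup>2)"

instantiation complex :: complex_hilbert
begin

definition scaleC_complex :: "complex \<Rightarrow> complex \<Rightarrow> complex"
  where "scaleC_complex c x = c * x"

definition cinner_complex :: "complex \<Rightarrow> complex \<Rightarrow> complex"
  where "cinner_complex x y = x * cnj y"

instance
  by standard
    (simp_all add: scaleC_complex_def cinner_complex_def algebra_simps norm_mult
      scaleR_conv_of_real complex_norm_square del: of_real_power)

end

lemma bounded_linear_scaleC: "bounded_linear (\<lambda>x :: 'a::complex_normed_vector. c *\<^sub>C x)"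
proof (rule bounded_linear_intro[where K = "cmod c"])
  show "c *\<^sub>C (r *\<^sub>R x) = r *\<^sub>R (c *\<^sub>C x)" for r and x :: 'a
    by (simp add: scaleC_of_real[symmetric] scaleC_scaleC mult.commute)
qed (simp_all add: scaleC_add_right norm_scaleC)

text \<open>The type \<open>blinfun\<close> consists of the bounded \<^emph>\<open>real\<close>-linear maps; complex
  linearity is imposed by membership in \<open>bounded_ops\<close>.\<close>

instantiation blinfun :: (real_normed_vector, complex_normed_vector) complex_normed_vector
begin

lift_definition scaleC_blinfun :: "complex \<Rightarrow> 'a \<Rightarrow>\<^sub>L 'b \<Rightarrow> 'a \<Rightarrow>\<^sub>L 'b"
  is "\<lambda>c T x. c *\<^sub>C T x"
  by (rule bounded_linear_compose[OF bounded_linear_scaleC])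

instance
proof
  fix c d :: complex and r :: real and S T :: "'a \<Rightarrow>\<^sub>L 'b"
  show "c *\<^sub>C (S + T) = c *\<^sub>C S + c *\<^sub>C T"
    by transfer (simp add: scaleC_add_right)
  show "(c + d) *\<^sub>C T = c *\<^sub>C T + d *\<^sub>C T"
    by transfer (simp add: scaleC_add_left)
  show "c *\<^sub>C d *\<^sub>C T = (c * d) *\<^sub>C T"
    by transfer (simp add: scaleC_scaleC)
  show "complex_of_real r *\<^sub>C T = r *\<^sub>R T"
    by transfer (simp add: scaleC_of_real)
  show "norm (c *\<^sub>C T) = cmod c * norm T"
  proof -
    have le: "norm (a *\<^sub>C R) \<le> cmod a * norm R" for a and R :: "'a \<Rightarrow>\<^sub>L 'b"
      by (rule norm_blinfun_bound)
        (auto simp: scaleC_blinfun.rep_eq norm_scaleC mult.assoc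
          intro!: mult_left_mono norm_blinfun)
    show ?thesis
    proof (cases "c = 0")
      case True
      then show ?thesis using le[of c T] by simp
    next
      case False
      have "inverse c *\<^sub>C c *\<^sub>C T = T"
        using False scaleC_of_real[of 1]
        by (intro blinfun_eqI) (simp add: scaleC_blinfun.rep_eq scaleC_scaleC)
      then have "norm T \<le> inverse (cmod c) * norm (c *\<^sub>C T)"
        using le[of "inverse c" "c *\<^sub>C T"] by (simp add: norm_inverse)
      then have "cmod c * norm T \<le> norm (c *\<^sub>C T)"
        using False by (simp add: field_simps)
      then show ?thesis using le[of c T] by simp
    qed
  qed
qed

end

definition bounded_ops :: "('a::complex_normed_vector \<Rightarrow>\<^sub>L 'b::complex_normed_vector) set"
  where "bounded_ops =
    {T. \<forall>c x. blinfun_apply T (c *\<^sub>C x) = c *\<^sub>C blinfun_apply T x}"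

definition cadjoint :: "('a::complex_hilbert \<Rightarrow>\<^sub>L 'b::complex_hilbert) \<Rightarrow> ('b \<Rightarrow>\<^sub>L 'a)"
  where "cadjoint T = (THE S. S \<in> bounded_ops \<and>
    (\<forall>x y. cinner (blinfun_apply T x) y = cinner x (blinfun_apply S y)))"

definition unitary :: "('a::complex_hilbert \<Rightarrow>\<^sub>L 'b::complex_hilbert) \<Rightarrow> bool"
  where "unitary U \<longleftrightarrow> U \<in> bounded_ops \<and> surj (blinfun_apply U) \<and>
    (\<forall>x y. cinner (blinfun_apply U x) (blinfun_apply U y) = cinner x y)"

definition orth_projection :: "('a::complex_hilbert \<Rightarrow>\<^sub>L 'a) \<Rightarrow> bool"
  where "orth_projection P \<longleftrightarrow> P \<in> bounded_ops \<and> P o\<^sub>L P = P \<and> cadjoint P = P"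

definition op_le :: "('a::complex_hilbert \<Rightarrow>\<^sub>L 'a) \<Rightarrow> ('a \<Rightarrow>\<^sub>L 'a) \<Rightarrow> bool"
  where "op_le A B \<longleftrightarrow> (\<forall>x. cinner (blinfun_apply (B - A) x) x \<in> \<real>\<^sub>\<ge>\<^sub>0)"

text \<open>\<open>op_prod T k\<close> is $T_1 T_2 \cdots T_k$ and \<open>op_prod_rev T k\<close> is
  $T_k \cdots T_2 T_1$.\<close>

primrec op_prod :: "(nat \<Rightarrow> ('a::real_normed_vector \<Rightarrow>\<^sub>L 'a)) \<Rightarrow> nat \<Rightarrow> ('a \<Rightarrow>\<^sub>L 'a)"
  where
    "op_prod T 0 = id_blinfun"
  | "op_prod T (Suc k) = op_prod T k o\<^sub>L T (Suc k)"

primrec op_prod_rev :: "(nat \<Rightarrow> ('a::real_normed_vector \<Rightarrow>\<^sub>L 'a)) \<Rightarrow> nat \<Rightarrow> ('a \<Rightarrow>\<^sub>L 'a)"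
  where
    "op_prod_rev T 0 = id_blinfun"
  | "op_prod_rev T (Suc k) = T (Suc k) o\<^sub>L op_prod_rev T k"

abbreviation unit_disc :: "complex set"
  where "unit_disc \<equiv> ball 0 1"

definition has_taylor_coeffs ::
    "(complex \<Rightarrow> 'a::complex_normed_vector) \<Rightarrow> (nat \<Rightarrow> 'a) \<Rightarrow> bool"
  where "has_taylor_coeffs f a \<longleftrightarrow> (\<forall>z\<in>unit_disc. (\<lambda>k. z ^ k *\<^sub>C a k) sums f z)"

text \<open>A function on the disc is encoded as a total function vanishing off the disc, so
  that equality in \<open>hardy2\<close> is equality on the disc.\<close>

definition hardy2 :: "(complex \<Rightarrow> 'a::complex_hilbert) set"
  where "hardy2 = {f. (\<forall>z. z \<notin> unit_disc \<longrightarrow> f z = 0) \<and>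
    (\<exists>a. has_taylor_coeffs f a \<and> summable (\<lambda>k. (norm (a k))\<^sup>2))}"

definition hardy2_norm :: "(complex \<Rightarrow> 'a::complex_hilbert) \<Rightarrow> real"
  where "hardy2_norm f = sqrt (\<Sum>k. (norm ((THE a. has_taylor_coeffs f a) k))\<^sup>2)"

definition closed_subspace_hardy2 :: "(complex \<Rightarrow> 'a::complex_hilbert) set \<Rightarrow> bool"
  where "closed_subspace_hardy2 S \<longleftrightarrow>
    S \<subseteq> hardy2 \<and> (\<lambda>z. 0) \<in> S \<and>
    (\<forall>f\<in>S. \<forall>g\<in>S. (\<lambda>z. f z + g z) \<in> S) \<and>
    (\<forall>c. \<forall>f\<in>S. (\<lambda>z. c *\<^sub>C f z) \<in> S) \<and>
    (\<forall>F f. (\<forall>m::nat. F m \<in> S) \<longrightarrow> f \<in> hardy2 \<longrightarrow>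
      (\<lambda>m. hardy2_norm (\<lambda>z. F m z - f z)) \<longlonglongrightarrow> 0 \<longrightarrow> f \<in> S)"

definition vholomorphic_on ::
    "(complex \<Rightarrow> 'a::complex_normed_vector) \<Rightarrow> complex set \<Rightarrow> bool"
  where "vholomorphic_on f A \<longleftrightarrow>
    (\<forall>z\<in>A. \<exists>d. (f has_derivative (\<lambda>h. h *\<^sub>C d)) (at z within A))"

text \<open>The values off the disc of an operator-valued symbol are irrelevant.\<close>

definition hardy_inf ::
    "(complex \<Rightarrow> ('a::complex_hilbert \<Rightarrow>\<^sub>L 'b::complex_hilbert)) set"
  where "hardy_inf = {\<Theta>. (\<forall>z\<in>unit_disc. \<Theta> z \<in> bounded_ops) \<and>
    vholomorphic_on \<Theta> unit_disc \<and> bounded (\<Theta> ` unit_disc)}"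

definition mult_op ::
    "(complex \<Rightarrow> ('a::complex_hilbert \<Rightarrow>\<^sub>L 'b::complex_hilbert)) \<Rightarrow>
      (complex \<Rightarrow> 'a) \<Rightarrow> (complex \<Rightarrow> 'b)"
  where "mult_op \<Theta> f =
    (\<lambda>z. if z \<in> unit_disc then blinfun_apply (\<Theta> z) (f z) else 0)"

definition inner_fun ::
    "(complex \<Rightarrow> ('a::complex_hilbert \<Rightarrow>\<^sub>L 'b::complex_hilbert)) \<Rightarrow> bool"
  where "inner_fun \<Theta> \<longleftrightarrow> \<Theta> \<in> hardy_inf \<and>
    (\<forall>f\<in>hardy2. mult_op \<Theta> f \<in> hardy2 \<and> hardy2_norm (mult_op \<Theta> f) = hardy2_norm f)"

definition model_symbol ::
    "('a::complex_hilbert \<Rightarrow>\<^sub>L 'a) \<Rightarrow> ('a \<Rightarrow>\<^sub>L 'a) \<Rightarrow> complex \<Rightarrow> ('a \<Rightarrow>\<^sub>L 'a)"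
  where "model_symbol U P z = U o\<^sub>L ((id_blinfun - P) + z *\<^sub>C P)"

text \<open>\<open>model_isometry n \<Phi>\<close> says that $(M_{\Phi_1},\ldots,M_{\Phi_n})$ is a model
  $n$-isometry; the tuple of multiplication operators is represented by its symbols,
  which it determines on the disc.\<close>

definition model_isometry ::
    "nat \<Rightarrow> (nat \<Rightarrow> complex \<Rightarrow> ('a::complex_hilbert \<Rightarrow>\<^sub>L 'a)) \<Rightarrow> bool"
  where "model_isometry n \<Phi> \<longleftrightarrow> (\<exists>U P.
    (\<forall>i\<in>{1..n}. unitary (U i) \<and> orth_projection (P i) \<and>
      (\<forall>z\<in>unit_disc. \<Phi> i z = model_symbol (U i) (P i) z)) \<and>
    (\<forall>i\<in>{1..n}. \<forall>j\<in>{1..n}. U i o\<^sub>L U j = U j o\<^sub>L U i) \<and>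
    op_prod U n = id_blinfun \<and>
    (\<forall>i\<in>{1..n}. \<forall>j\<in>{1..n}. i \<noteq> j \<longrightarrow>
      P i + (cadjoint (U i) o\<^sub>L P j o\<^sub>L U i) = P j + (cadjoint (U j) o\<^sub>L P i o\<^sub>L U j) \<and>
      op_le (P i + (cadjoint (U i) o\<^sub>L P j o\<^sub>L U i)) id_blinfun) \<and>
    (\<Sum>k = 1..n. op_prod (\<lambda>i. cadjoint (U i)) (k - 1) o\<^sub>L P k o\<^sub>L op_prod_rev U (k - 1))
      = id_blinfun)"

end

(* The unitary M_Theta-hat^{-1} M_Theta from H^2(W_* ) to H^2(W-hat) commutes with multiplication
   by z, hence maps the constants (the orthogonal complement of z H^2) onto the constants; its
   restriction to them is tau.  Orthogonality to z H^2 enters only through the Pythagorean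
   identity |x + z f|^2 = |x|^2 + |f|^2, so no inner product on H^2 is needed.  The relation
   between Psi and Psi-hat is cancelled through M_Theta-hat as a whole, because a single value
   of Theta-hat need not be injective. *)
theory Submission
  imports Defs
begin

section \<open>Complex scalars and the inner product\<close>

lemma scaleC_one [simp]: "1 *\<^sub>C x = (x :: 'a::complex_normed_vector)"
  using scaleC_of_real[of 1 x] by simp

lemma scaleC_zero_left [simp]: "0 *\<^sub>C x = (0 :: 'a::complex_normed_vector)"
  using scaleC_of_real[of 0 x] by simp

lemma scaleC_zero_right [simp]: "c *\<^sub>C 0 = (0 :: 'a::complex_normed_vector)"
  using norm_scaleC[of c "0::'a"] by simp

lemma scaleC_minus_right: "c *\<^sub>C (- x) = - (c *\<^sub>C (x :: 'a::complex_normed_vector))"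
  using scaleC_add_right[of c x "- x"] by (simp add: add_eq_0_iff)

lemma scaleC_diff_right: "c *\<^sub>C (x - y) = c *\<^sub>C x - c *\<^sub>C (y :: 'a::complex_normed_vector)"
  using scaleC_add_right[of c x "- y"] by (simp add: scaleC_minus_right)

lemma cinner_add_right: "cinner x (y + z) = cinner x y + cinner x (z :: 'a::complex_hilbert)"
  by (metis cinner_add_left cinner_commute complex_cnj_add)

lemma cinner_scaleC_right: "cinner x (c *\<^sub>C y) = cnj c * cinner x (y :: 'a::complex_hilbert)"
  by (metis cinner_scaleC_left cinner_commute complex_cnj_mult)

lemma cinner_zero_left [simp]: "cinner 0 (y :: 'a::complex_hilbert) = 0"
  using cinner_scaleC_left[of 0 0 y] by simp

lemma cinner_sum_left: "cinner (sum f A) (y :: 'a::complex_hilbert) = (\<Sum>a\<in>A. cinner (f a) y)"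
  by (induction A rule: infinite_finite_induct) (simp_all add: cinner_add_left)

text \<open>Differences are written as \<open>x + c *\<^sub>C y\<close> with c = -1 and c = -\<i>,
  so that one statement about the norms of such combinations rewrites the terms uniformly.\<close>

lemma polarization:
  fixes x y :: "'a::complex_hilbert"
  shows "4 * cinner x y =
    of_real ((norm (x + y))\<^sup>2) - of_real ((norm (x + (-1) *\<^sub>C y))\<^sup>2)
    + \<i> * (of_real ((norm (x + \<i> *\<^sub>C y))\<^sup>2) - of_real ((norm (x + (-\<i>) *\<^sub>C y))\<^sup>2))"
  unfolding cinner_self[symmetric]
  by (simp add: cinner_add_left cinner_add_right cinner_scaleC_left cinner_scaleC_right algebra_simps)

text \<open>Polarization expresses the inner product through norms, so its continuity follows from
  that of the norm, without the Cauchy-Schwarz inequality.\<close>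

lemma tendsto_cinner_left:
  fixes y :: "'a::complex_hilbert"
  assumes "(f \<longlongrightarrow> x) F"
  shows "((\<lambda>n. cinner (f n) y) \<longlongrightarrow> cinner x y) F"
proof -
  have *: "cinner u y = (of_real ((norm (u + y))\<^sup>2) - of_real ((norm (u + (-1) *\<^sub>C y))\<^sup>2)
    + \<i> * (of_real ((norm (u + \<i> *\<^sub>C y))\<^sup>2) - of_real ((norm (u + (-\<i>) *\<^sub>C y))\<^sup>2))) / 4" for u
    using polarization[of u y] by (simp add: mult.commute)
  show ?thesis
    unfolding * by (intro tendsto_intros assms) simp
qed

lemma sums_cinner_left:
  fixes y :: "'a::complex_hilbert"
  shows "f sums x \<Longrightarrow> (\<lambda>n. cinner (f n) y) sums cinner x y"
  unfolding sums_def using tendsto_cinner_left by (fastforce simp: cinner_sum_left)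

section \<open>Uniqueness of Taylor coefficients\<close>

lemma power_series_zero_coeffs:
  fixes a :: "nat \<Rightarrow> complex"
  assumes "\<And>z. z \<in> unit_disc \<Longrightarrow> (\<lambda>k. a k * z ^ k) sums 0"
  shows "a n = 0"
proof (induction n rule: less_induct)
  case (less n)
  \<comment> \<open>By induction the first \<open>n\<close> coefficients vanish, so
    \<open>z ^ n\<close> can be divided out. The punctured disc suffices, since \<open>a n\<close>
    is then recovered as the limit at 0.\<close>
  have "(\<lambda>k. a (k + n) * z ^ k) sums 0" if "z \<noteq> 0" "norm z < 1" for z
  proof -
    have "(\<lambda>k. a (k + n) * z ^ (k + n)) sums 0"
      using that assms[of z] less by (subst sums_iff_shift) simp
    from sums_mult[OF this, of "inverse (z ^ n)"] show ?thesis
      using that by (simp add: power_add field_simps)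
  qed
  then have "((\<lambda>_. 0) \<longlongrightarrow> a n) (at (0::complex))"
    using powser_limit_0_strong[of 1 "\<lambda>k. a (k + n)" "\<lambda>_. 0"] by simp
  then show ?case
    using tendsto_unique[OF _ _ tendsto_const] by (metis trivial_limit_at)
qed

text \<open>Pairing both series with the fixed vector \<open>a n - b n\<close> reduces to the scalar
  case; the n-th scalar coefficient is then the squared norm of that vector.\<close>

lemma has_taylor_coeffs_unique:
  fixes f :: "complex \<Rightarrow> 'a::complex_hilbert"
  assumes "has_taylor_coeffs f a" "has_taylor_coeffs f b"
  shows "a = b"
proof
  fix n
  let ?d = "a n - b n"
  have "(\<lambda>k. cinner (a k - b k) ?d * z ^ k) sums 0" if "z \<in> unit_disc" for z
  proof -
    have "(\<lambda>k. z ^ k *\<^sub>C (a k - b k)) sums 0"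
      using sums_diff[of "\<lambda>k. z ^ k *\<^sub>C a k" "f z" "\<lambda>k. z ^ k *\<^sub>C b k" "f z"] assms that
      by (simp add: has_taylor_coeffs_def scaleC_diff_right)
    from sums_cinner_left[OF this, of ?d] show ?thesis
      by (simp add: cinner_scaleC_left mult.commute)
  qed
  from power_series_zero_coeffs[OF this, of n] show "a n = b n"
    by (simp add: cinner_self)
qed

section \<open>The Hardy norm and the splitting g = x + z f\<close>

lemma hardy2_norm_power2:
  fixes f :: "complex \<Rightarrow> 'a::complex_hilbert"
  assumes "has_taylor_coeffs f a" "summable (\<lambda>k. (norm (a k))\<^sup>2)"
  shows "(hardy2_norm f)\<^sup>2 = (\<Sum>k. (norm (a k))\<^sup>2)"
proof -
  have "(THE b. has_taylor_coeffs f b) = a"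
    using assms(1) has_taylor_coeffs_unique by blast
  then show ?thesis
    using assms(2) by (simp add: hardy2_norm_def suminf_nonneg)
qed

lemma zero_in_hardy2: "(\<lambda>z. 0) \<in> hardy2"
  unfolding hardy2_def has_taylor_coeffs_def by (auto intro!: exI[of _ "\<lambda>k. 0"])

lemma hardy2_norm_zero: "hardy2_norm (\<lambda>z. 0 :: 'a::complex_hilbert) = 0"
  using hardy2_norm_power2[of "\<lambda>z. 0 :: 'a" "\<lambda>k. 0"] by (simp add: has_taylor_coeffs_def)

text \<open>A vanishing sum of squares kills every Taylor coefficient, hence the function on the
  disc; off the disc it is zero by the encoding of \<open>hardy2\<close>.\<close>

lemma hardy2_norm_eq_0_imp:
  fixes f :: "complex \<Rightarrow> 'a::complex_hilbert"
  assumes "f \<in> hardy2" "hardy2_norm f = 0"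
  shows "f = (\<lambda>z. 0)"
proof
  fix z
  obtain a where off: "\<And>z. z \<notin> unit_disc \<Longrightarrow> f z = 0"
    and a: "has_taylor_coeffs f a" and s: "summable (\<lambda>k. (norm (a k))\<^sup>2)"
    using assms(1) unfolding hardy2_def by blast
  have "a = (\<lambda>k. 0)"
    using hardy2_norm_power2[OF a s] assms(2) suminf_eq_zero_iff[OF s] by auto
  then show "f z = 0"
    using a off[of z] sums_unique2[OF sums_zero, of "f z"]
    by (cases "z \<in> unit_disc") (auto simp: has_taylor_coeffs_def)
qed

lemma uminus_in_hardy2:
  assumes "f \<in> hardy2"
  shows "(\<lambda>z. - f z) \<in> hardy2"
proof -
  obtain a where "\<And>z. z \<notin> unit_disc \<Longrightarrow> f z = 0"
    and "has_taylor_coeffs f a" and "summable (\<lambda>k. (norm (a k))\<^sup>2)"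
    using assms unfolding hardy2_def by blast
  then show ?thesis
    unfolding hardy2_def has_taylor_coeffs_def
    by (auto intro!: exI[of _ "\<lambda>k. - a k"] sums_minus simp: scaleC_minus_right)
qed

text \<open>This is x + z f: a constant plus the image of \<open>f\<close> under the unilateral
  shift. It is cut off outside the disc because members of \<open>hardy2\<close> must vanish
  there.\<close>

definition shift_in :: "'a \<Rightarrow> (complex \<Rightarrow> 'a) \<Rightarrow> complex \<Rightarrow> 'a::complex_normed_vector"
  where "shift_in x f = (\<lambda>z. if z \<in> unit_disc then x + z *\<^sub>C f z else 0)"

lemma has_taylor_coeffs_shift_in:
  assumes "has_taylor_coeffs f a"
  shows "has_taylor_coeffs (shift_in x f) (case_nat x a)"
  unfolding has_taylor_coeffs_def
proof
  fix z :: complex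
  assume z: "z \<in> unit_disc"
  have "(\<lambda>k. z *\<^sub>C z ^ k *\<^sub>C a k) sums (z *\<^sub>C f z)"
    using assms z bounded_linear.sums[OF bounded_linear_scaleC]
    unfolding has_taylor_coeffs_def by blast
  then have "(\<lambda>k. z ^ k *\<^sub>C case_nat x a k) sums (z *\<^sub>C f z + x)"
    using sums_Suc_iff[of "\<lambda>k. z ^ k *\<^sub>C case_nat x a k" "z *\<^sub>C f z"] by (simp add: scaleC_scaleC)
  then show "(\<lambda>k. z ^ k *\<^sub>C case_nat x a k) sums shift_in x f z"
    using z by (simp add: shift_in_def add.commute)
qed

text \<open>The coefficients of x + z f are those of \<open>f\<close> with \<open>x\<close> put in
  front, which yields membership and the Pythagorean identity at once.\<close>

lemma
  assumes "f \<in> hardy2"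
  shows shift_in_hardy2: "shift_in x f \<in> hardy2"
    and hardy2_norm_shift_in: "(hardy2_norm (shift_in x f))\<^sup>2 = (norm x)\<^sup>2 + (hardy2_norm f)\<^sup>2"
proof -
  obtain a where a: "has_taylor_coeffs f a" and s: "summable (\<lambda>k. (norm (a k))\<^sup>2)"
    using assms unfolding hardy2_def by blast
  let ?b = "case_nat x a"
  have b: "has_taylor_coeffs (shift_in x f) ?b"
    by (rule has_taylor_coeffs_shift_in[OF a])
  have sb: "summable (\<lambda>k. (norm (?b k))\<^sup>2)"
    using s summable_Suc_iff[of "\<lambda>k. (norm (?b k))\<^sup>2"] by simp
  show "shift_in x f \<in> hardy2"
    unfolding hardy2_def using b sb by (auto simp: shift_in_def)
  show "(hardy2_norm (shift_in x f))\<^sup>2 = (norm x)\<^sup>2 + (hardy2_norm f)\<^sup>2"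
    using hardy2_norm_power2[OF b sb] hardy2_norm_power2[OF a s] suminf_split_head[OF sb] by simp
qed

text \<open>The bound u v \<le> u^2 + v^2 dominates the norms of the terms by a geometric series
  with ratio |z|^2 plus the given series of squares.\<close>

lemma summable_powser_square_summable:
  fixes a :: "nat \<Rightarrow> 'a::complex_hilbert"
  assumes "summable (\<lambda>k. (norm (a k))\<^sup>2)" "z \<in> unit_disc"
  shows "summable (\<lambda>k. z ^ k *\<^sub>C a k)"
proof (rule summable_norm_cancel, rule summable_comparison_test')
  have "norm (z\<^sup>2) < 1"
    using assms(2) by (simp add: norm_power power_less_one_iff)
  then have "summable (\<lambda>k. norm (z\<^sup>2) ^ k)"
    by (intro summable_geometric) simp
  then show "summable (\<lambda>k. norm (z\<^sup>2) ^ k + (norm (a k))\<^sup>2)"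
    using assms(1) by (rule summable_add)
  show "norm (norm (z ^ k *\<^sub>C a k)) \<le> norm (z\<^sup>2) ^ k + (norm (a k))\<^sup>2" if "k \<ge> 0" for k
  proof -
    have "u * v \<le> u\<^sup>2 + v\<^sup>2" if "u \<ge> 0" "v \<ge> 0" for u v :: real
      using that sum_squares_bound[of u v] mult_nonneg_nonneg[OF that] by linarith
    from this[of "cmod z ^ k" "norm (a k)"] show ?thesis
      by (simp add: norm_scaleC norm_power power_mult[symmetric] mult.commute)
  qed
qed

text \<open>Here \<open>x\<close> is the constant term and \<open>f\<close> the backward shift of
  \<open>g\<close>. Defining \<open>f\<close> by its power series avoids dividing by z at the
  origin.\<close>

lemma hardy2_eq_shift_inE:
  fixes g :: "complex \<Rightarrow> 'a::complex_hilbert"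
  assumes "g \<in> hardy2"
  obtains x f where "f \<in> hardy2" "g = shift_in x f"
proof -
  obtain a where off: "\<And>z. z \<notin> unit_disc \<Longrightarrow> g z = 0"
    and a: "has_taylor_coeffs g a" and s: "summable (\<lambda>k. (norm (a k))\<^sup>2)"
    using assms unfolding hardy2_def by blast
  define b where "b k = a (Suc k)" for k
  define f where "f z = (if z \<in> unit_disc then \<Sum>k. z ^ k *\<^sub>C b k else 0)" for z
  have sb: "summable (\<lambda>k. (norm (b k))\<^sup>2)"
    unfolding b_def using s summable_Suc_iff[of "\<lambda>k. (norm (a k))\<^sup>2"] by simp
  have b: "has_taylor_coeffs f b"
    unfolding has_taylor_coeffs_def f_def
    using summable_powser_square_summable[OF sb] by (auto intro: summable_sums)
  have "case_nat (a 0) b = a"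
    by (auto simp: b_def fun_eq_iff split: nat.split)
  then have "has_taylor_coeffs (shift_in (a 0) f) a"
    using has_taylor_coeffs_shift_in[OF b, of "a 0"] by simp
  then have "g z = shift_in (a 0) f z" for z
    using a off[of z] unfolding has_taylor_coeffs_def
    by (cases "z \<in> unit_disc") (blast intro: sums_unique2, simp add: shift_in_def)
  moreover have "f \<in> hardy2"
    unfolding hardy2_def using b sb by (auto simp: f_def)
  ultimately show thesis
    using that by blast
qed

section \<open>Inner functions: injectivity and comparison of ranges\<close>

lemma inner_fun_in_bounded_ops: "inner_fun \<Theta> \<Longrightarrow> z \<in> unit_disc \<Longrightarrow> \<Theta> z \<in> bounded_ops"
  by (simp add: inner_fun_def hardy_inf_def)

lemma bounded_opsD: "T \<in> bounded_ops \<Longrightarrow> T (c *\<^sub>C x) = c *\<^sub>C T x"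
  by (simp add: bounded_ops_def)

lemma inner_fun_norm:
  "inner_fun \<Theta> \<Longrightarrow> f \<in> hardy2 \<Longrightarrow> hardy2_norm (mult_op \<Theta> f) = hardy2_norm f"
  by (simp add: inner_fun_def)

text \<open>Multiplication by an inner function is isometric on the whole Hardy space, hence
  injective there, even if some values \<open>\<Theta> z\<close> have a kernel.\<close>

lemma inner_fun_kernel:
  assumes "inner_fun \<Theta>" "f \<in> hardy2" "\<And>z. z \<in> unit_disc \<Longrightarrow> \<Theta> z (f z) = 0"
  shows "f = (\<lambda>z. 0)"
proof (rule hardy2_norm_eq_0_imp[OF assms(2)])
  have "mult_op \<Theta> f = (\<lambda>z. 0)"
    using assms(3) by (auto simp: mult_op_def)
  then show "hardy2_norm f = 0"
    using inner_fun_norm[OF assms(1,2)] by (simp add: hardy2_norm_zero)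
qed

text \<open>Polynomials of degree at most one lie in the Hardy space. This case covers constants as
  well as model symbols applied to a fixed vector, which are affine in z.\<close>

lemma inner_fun_affine_kernel:
  assumes "inner_fun \<Theta>" "\<And>z. z \<in> unit_disc \<Longrightarrow> \<Theta> z (x + z *\<^sub>C y) = 0"
    and "z \<in> unit_disc"
  shows "x + z *\<^sub>C y = 0"
proof -
  let ?f = "shift_in x (shift_in y (\<lambda>z. 0))"
  have f: "?f z = x + z *\<^sub>C y" if "z \<in> unit_disc" for z
    using that by (simp add: shift_in_def)
  have "?f = (\<lambda>z. 0)"
    using assms(2) f
    by (intro inner_fun_kernel[OF assms(1)] shift_in_hardy2 zero_in_hardy2) simp
  then show ?thesis
    using f[OF assms(3)] by simp
qed

lemma inner_fun_const_inject:
  assumes "inner_fun \<Theta>" "\<And>z. z \<in> unit_disc \<Longrightarrow> \<Theta> z x = \<Theta> z y"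
  shows "x = y"
  using inner_fun_affine_kernel[of \<Theta> "x - y" 0 0] assms by (simp add: blinfun.diff_right)

text \<open>Equality of the ranges gives \<Theta> x = \<Theta>' (y + z k) and \<Theta>' k = \<Theta>
  f, hence also \<Theta> (x - z f) = \<Theta>' y. Comparing norms in both identities leaves no room
  for \<open>k\<close>.\<close>

lemma inner_fun_const_transfer:
  fixes \<Theta> :: "complex \<Rightarrow> ('a::complex_hilbert \<Rightarrow>\<^sub>L 'c::complex_hilbert)"
    and \<Theta>' :: "complex \<Rightarrow> ('b::complex_hilbert \<Rightarrow>\<^sub>L 'c)"
  assumes \<Theta>: "inner_fun \<Theta>" and \<Theta>': "inner_fun \<Theta>'"
    and range_eq: "mult_op \<Theta> ` hardy2 = mult_op \<Theta>' ` hardy2"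
  obtains y where "norm y = norm x" "\<And>z. z \<in> unit_disc \<Longrightarrow> \<Theta> z x = \<Theta>' z y"
proof -
  have "mult_op \<Theta> (shift_in x (\<lambda>z. 0)) \<in> mult_op \<Theta>' ` hardy2"
    using range_eq shift_in_hardy2[OF zero_in_hardy2] by blast
  then obtain g where g: "g \<in> hardy2" "mult_op \<Theta> (shift_in x (\<lambda>z. 0)) = mult_op \<Theta>' g"
    by blast
  obtain y k where k: "k \<in> hardy2" and g_eq: "g = shift_in y k"
    using hardy2_eq_shift_inE[OF g(1)] by blast
  \<comment> \<open>Pulling \<open>k\<close> back to the \<Theta> side allows the term z k to be
    moved across the equation, which supplies the second norm identity.\<close>
  obtain f where f: "f \<in> hardy2" and fk: "mult_op \<Theta>' k = mult_op \<Theta> f"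
    using range_eq k by blast
  have eq: "\<Theta> z x = \<Theta>' z y + z *\<^sub>C \<Theta>' z (k z)" if "z \<in> unit_disc" for z
    using fun_cong[OF g(2), of z] that bounded_opsD[OF inner_fun_in_bounded_ops[OF \<Theta>' that]]
    by (simp add: mult_op_def g_eq shift_in_def blinfun.add_right)
  have eq2: "\<Theta>' z (k z) = \<Theta> z (f z)" if "z \<in> unit_disc" for z
    using fun_cong[OF fk, of z] that by (simp add: mult_op_def)
  have "mult_op \<Theta> (shift_in x (\<lambda>z. - f z)) = mult_op \<Theta>' (shift_in y (\<lambda>z. 0))"
  proof
    fix z
    show "mult_op \<Theta> (shift_in x (\<lambda>z. - f z)) z = mult_op \<Theta>' (shift_in y (\<lambda>z. 0)) z"
    proof (cases "z \<in> unit_disc")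
      case True
      then show ?thesis
        using eq[OF True] eq2[OF True] bounded_opsD[OF inner_fun_in_bounded_ops[OF \<Theta> True]]
        by (simp add: mult_op_def shift_in_def blinfun.add_right blinfun.minus_right
            scaleC_minus_right blinfun.diff_right)
    qed (simp add: mult_op_def)
  qed
  then have "hardy2_norm (shift_in x (\<lambda>z. - f z)) = hardy2_norm (shift_in y (\<lambda>z. 0))"
    using inner_fun_norm[OF \<Theta>] inner_fun_norm[OF \<Theta>'] shift_in_hardy2 uminus_in_hardy2[OF f]
      zero_in_hardy2 by metis
  then have 1: "(norm x)\<^sup>2 + (hardy2_norm (\<lambda>z. - f z))\<^sup>2 = (norm y)\<^sup>2"
    using hardy2_norm_shift_in[OF uminus_in_hardy2[OF f], of x]
      hardy2_norm_shift_in[OF zero_in_hardy2, of y] by (simp add: hardy2_norm_zero)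
  have "hardy2_norm (shift_in x (\<lambda>z. 0)) = hardy2_norm g"
    using g inner_fun_norm[OF \<Theta>] inner_fun_norm[OF \<Theta>'] shift_in_hardy2 zero_in_hardy2 by metis
  then have 2: "(norm x)\<^sup>2 = (norm y)\<^sup>2 + (hardy2_norm k)\<^sup>2"
    using hardy2_norm_shift_in[OF k, of y] hardy2_norm_shift_in[OF zero_in_hardy2, of x]
    by (simp add: hardy2_norm_zero g_eq)
  \<comment> \<open>Substituting one identity into the other cancels the norms of \<open>x\<close>
    and \<open>y\<close> and leaves a sum of two squares equal to zero.\<close>
  have "(hardy2_norm k)\<^sup>2 + (hardy2_norm (\<lambda>z. - f z))\<^sup>2 = 0"
    using 1 2 by linarith
  then have "hardy2_norm k = 0"
    by (simp add: sum_power2_eq_zero_iff)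
  with k have k0: "k = (\<lambda>z. 0)"
    by (rule hardy2_norm_eq_0_imp)
  show thesis
  proof (rule that)
    show "norm y = norm x"
      using 2 \<open>hardy2_norm k = 0\<close> by simp
    show "\<Theta> z x = \<Theta>' z y" if "z \<in> unit_disc" for z
      using eq[OF that] k0 by (simp add: blinfun.zero_right)
  qed
qed

section \<open>The unitary between the coefficient spaces\<close>

lemma unitary_if_surj_norm_preserving:
  fixes T :: "'a::complex_hilbert \<Rightarrow>\<^sub>L 'b::complex_hilbert"
  assumes "T \<in> bounded_ops" "surj T" "\<And>x. norm (T x) = norm x"
  shows "unitary T"
proof -
  have "norm (T x + c *\<^sub>C T y) = norm (x + c *\<^sub>C y)" for x y c
    using assms(3)[of "x + c *\<^sub>C y"] bounded_opsD[OF assms(1)] by (simp add: blinfun.add_right)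
  \<comment> \<open>The instance c = 1 is listed separately because the first term of the
    polarization identity carries no scalar.\<close>
  from this this[where c = 1] have "4 * cinner (T x) (T y) = 4 * cinner x y" for x y
    unfolding polarization by simp
  then show ?thesis
    using assms by (simp add: unitary_def)
qed

text \<open>Each constant has a counterpart of the same norm under \<Theta>'. It is determined by
  the values of \<Theta>', so the pointwise choice \<open>t\<close> is automatically linear, and
  exchanging the two inner functions makes it onto.\<close>

lemma inner_fun_eq_comp_unitary:
  fixes \<Theta> :: "complex \<Rightarrow> ('a::complex_hilbert \<Rightarrow>\<^sub>L 'c::complex_hilbert)"
    and \<Theta>' :: "complex \<Rightarrow> ('b::complex_hilbert \<Rightarrow>\<^sub>L 'c)"
  assumes \<Theta>: "inner_fun \<Theta>" and \<Theta>': "inner_fun \<Theta>'"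
    and range_eq: "mult_op \<Theta> ` hardy2 = mult_op \<Theta>' ` hardy2"
  obtains \<tau> where "unitary \<tau>" "\<And>z. z \<in> unit_disc \<Longrightarrow> \<Theta> z = \<Theta>' z o\<^sub>L \<tau>"
proof -
  have "\<exists>y. norm y = norm x \<and> (\<forall>z\<in>unit_disc. \<Theta> z x = \<Theta>' z y)" for x
    using inner_fun_const_transfer[OF assms] by metis
  then obtain t where norm_t: "\<And>x. norm (t x) = norm x"
    and t: "\<And>x z. z \<in> unit_disc \<Longrightarrow> \<Theta> z x = \<Theta>' z (t x)"
    by metis
  have t_add: "t (x + y) = t x + t y" for x y
    by (rule inner_fun_const_inject[OF \<Theta>']) (simp add: t[symmetric] blinfun.add_right)
  have t_scaleC: "t (c *\<^sub>C x) = c *\<^sub>C t x" for c x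
    by (rule inner_fun_const_inject[OF \<Theta>'])
      (simp add: t[symmetric] bounded_opsD inner_fun_in_bounded_ops \<Theta> \<Theta>')
  have "bounded_linear t"
  proof (rule bounded_linear_intro[where K = 1])
    show "t (r *\<^sub>R x) = r *\<^sub>R t x" for r x
      using t_scaleC[of "of_real r" x] by (simp add: scaleC_of_real)
  qed (simp_all add: t_add norm_t)
  then have app: "blinfun_apply (Blinfun t) = t"
    by (rule bounded_linear_Blinfun_apply)
  have "\<exists>x. y = t x" for y
  proof -
    obtain x where x: "\<And>z. z \<in> unit_disc \<Longrightarrow> \<Theta>' z y = \<Theta> z x"
      using inner_fun_const_transfer[OF \<Theta>' \<Theta> range_eq[symmetric]] by metis
    \<comment> \<open>Both vectors have the same image \<open>\<Theta> z x\<close> under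
      \<open>\<Theta>' z\<close> for every z in the disc, so injectivity on constants identifies
      them.\<close>
    have "y = t x"
      by (rule inner_fun_const_inject[OF \<Theta>']) (simp add: t[symmetric] x)
    then show ?thesis ..
  qed
  then have "surj t"
    by (simp add: surj_def)
  then have "unitary (Blinfun t)"
    by (intro unitary_if_surj_norm_preserving)
      (simp_all add: app bounded_ops_def t_scaleC norm_t)
  moreover have "\<Theta> z = \<Theta>' z o\<^sub>L Blinfun t" if "z \<in> unit_disc" for z
    by (rule blinfun_eqI) (simp add: app t[OF that])
  ultimately show thesis
    by (rule that)
qed

section \<open>Model symbols and the intertwining relation\<close>

lemma model_symbol_apply:
  assumes "unitary U"
  shows "model_symbol U P z x = U (x - P x) + z *\<^sub>C U (P x)"
  using bounded_opsD[of U] assms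
  by (simp add: model_symbol_def unitary_def blinfun.add_left blinfun.diff_left blinfun.add_right
      scaleC_blinfun.rep_eq)

text \<open>With A = U (I - P) and B = U P, this extracts the affine dependence on z, which places
  the difference of the two intertwined sides within reach of
  \<open>inner_fun_affine_kernel\<close>.\<close>

lemma model_isometry_affine:
  assumes "model_isometry n \<Phi>" "i \<in> {1..n}"
  obtains A B where "\<And>z x. z \<in> unit_disc \<Longrightarrow> \<Phi> i z x = blinfun_apply A x + z *\<^sub>C blinfun_apply B x"
proof -
  obtain U P where "unitary U" "\<And>z. z \<in> unit_disc \<Longrightarrow> \<Phi> i z = model_symbol U P z"
    using assms unfolding model_isometry_def by metis
  then have "\<Phi> i z x = (U o\<^sub>L (id_blinfun - P)) x + z *\<^sub>C (U o\<^sub>L P) x" if "z \<in> unit_disc" for z x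
    using that by (simp add: model_symbol_apply blinfun.diff_left)
  then show thesis
    by (rule that)
qed

theorem mainTheorem5:
  fixes n :: nat
    and \<Phi> :: "nat \<Rightarrow> complex \<Rightarrow> ('w::complex_hilbert \<Rightarrow>\<^sub>L 'w)"
    and \<Psi> :: "nat \<Rightarrow> complex \<Rightarrow> ('ws::complex_hilbert \<Rightarrow>\<^sub>L 'ws)"
    and \<Psi>h :: "nat \<Rightarrow> complex \<Rightarrow> ('wh::complex_hilbert \<Rightarrow>\<^sub>L 'wh)"
    and \<Theta> :: "complex \<Rightarrow> ('ws \<Rightarrow>\<^sub>L 'w)"
    and \<Theta>h :: "complex \<Rightarrow> ('wh \<Rightarrow>\<^sub>L 'w)"
    and S :: "(complex \<Rightarrow> 'w) set"
  assumes "n \<ge> 2"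
    and "model_isometry n \<Phi>"
    and "closed_subspace_hardy2 S"
    and "inner_fun \<Theta>"
    and "model_isometry n \<Psi>"
    and "S = mult_op \<Theta> ` hardy2"
    and "\<forall>i\<in>{1..n}. \<forall>z\<in>unit_disc. \<Phi> i z o\<^sub>L \<Theta> z = \<Theta> z o\<^sub>L \<Psi> i z"
    and "inner_fun \<Theta>h"
    and "model_isometry n \<Psi>h"
    and "S = mult_op \<Theta>h ` hardy2"
    and "\<forall>i\<in>{1..n}. \<forall>z\<in>unit_disc. \<Phi> i z o\<^sub>L \<Theta>h z = \<Theta>h z o\<^sub>L \<Psi>h i z"
  shows "\<exists>\<tau> :: 'ws \<Rightarrow>\<^sub>L 'wh. unitary \<tau> \<and>
    (\<forall>z\<in>unit_disc. \<Theta> z = \<Theta>h z o\<^sub>L \<tau>) \<and>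
    (\<forall>j\<in>{1..n}. \<forall>z\<in>unit_disc. \<Psi>h j z o\<^sub>L \<tau> = \<tau> o\<^sub>L \<Psi> j z)"
proof -
  have "mult_op \<Theta> ` hardy2 = mult_op \<Theta>h ` hardy2"
    using assms(6,10) by simp
  then obtain \<tau> where \<tau>: "unitary \<tau>" and eq: "\<And>z. z \<in> unit_disc \<Longrightarrow> \<Theta> z = \<Theta>h z o\<^sub>L \<tau>"
    using inner_fun_eq_comp_unitary[OF assms(4,8)] by metis
  have "\<Psi>h j z o\<^sub>L \<tau> = \<tau> o\<^sub>L \<Psi> j z" if j: "j \<in> {1..n}" and z: "z \<in> unit_disc" for j z
  proof (rule blinfun_eqI)
    fix x
    obtain A B where AB: "\<And>z x. z \<in> unit_disc \<Longrightarrow> \<Psi> j z x = blinfun_apply A x + z *\<^sub>C blinfun_apply B x"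
      using model_isometry_affine[OF assms(5) j] by blast
    obtain C D where CD: "\<And>z x. z \<in> unit_disc \<Longrightarrow> \<Psi>h j z x = blinfun_apply C x + z *\<^sub>C blinfun_apply D x"
      using model_isometry_affine[OF assms(9) j] by blast
    have \<tau>_scaleC: "\<tau> (c *\<^sub>C y) = c *\<^sub>C \<tau> y" for c y
      using \<tau> by (simp add: unitary_def bounded_opsD)
    \<comment> \<open>For fixed \<open>x\<close> the defect of the intertwining relation is a
      polynomial of degree at most one in \<open>w\<close>.\<close>
    have diff: "\<Psi>h j w (\<tau> x) - \<tau> (\<Psi> j w x)
        = (C (\<tau> x) - \<tau> (A x)) + w *\<^sub>C (D (\<tau> x) - \<tau> (B x))" if "w \<in> unit_disc" for w
      using that by (simp add: AB CD blinfun.add_right \<tau>_scaleC scaleC_diff_right)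
    \<comment> \<open>Both terms are carried to \<open>\<Phi> j w (\<Theta> w x)\<close>. The
      identity is needed at every \<open>w\<close> and not just at \<open>z\<close>, since
      \<open>\<Theta>h\<close> can only be cancelled over the whole disc.\<close>
    have "\<Theta>h w (\<Psi>h j w (\<tau> x) - \<tau> (\<Psi> j w x)) = 0" if w: "w \<in> unit_disc" for w
    proof -
      have "\<Theta>h w (\<Psi>h j w (\<tau> x)) = \<Phi> j w (\<Theta>h w (\<tau> x))"
        using assms(11) j w by (metis blinfun_apply_blinfun_compose)
      also have "\<dots> = \<Phi> j w (\<Theta> w x)"
        using eq[OF w] by simp
      also have "\<dots> = \<Theta> w (\<Psi> j w x)"
        using assms(7) j w by (metis blinfun_apply_blinfun_compose)
      also have "\<dots> = \<Theta>h w (\<tau> (\<Psi> j w x))"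
        using eq[OF w] by simp
      finally show ?thesis
        by (simp add: blinfun.diff_right)
    qed
    then have "\<Psi>h j z (\<tau> x) - \<tau> (\<Psi> j z x) = 0"
      using inner_fun_affine_kernel[OF assms(8) _ z] diff z by metis
    then show "(\<Psi>h j z o\<^sub>L \<tau>) x = (\<tau> o\<^sub>L \<Psi> j z) x"
      by simp
  qed
  with \<tau> eq show ?thesis
    by blast
qed

end
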